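(* Let $p$ be a prime, let $A$ be a finite abelian $p$-group with $|A| > 1$, let $N, r \in \mathbb{N}$, and let $f_1, \ldots, f_r : A^N \to A$ be functions with $$N > \sum_{i=1}^r \operatorname{Fdeg}(f_i).$$ Then the set $V(f_1,\ldots,f_r) := \{ \mathbf{a} \in A^N \mid f_1(\mathbf{a}) = \cdots = f_r(\mathbf{a}) = 0\}$ is not a singleton.
   Context: $\mathbb{N}$ is the set of positive integers, $\mathbb{N}_0 = \mathbb{N} \cup \{0\}$; abelian groups are written additively. For an abelian group $A$, $\mathbb{Z}[A]$ is the integral group ring; its elements are written as finite sums $\sum_{a\in A} z_a \tau_a$ with $z_a \in \mathbb{Z}$, and $\tau_a \cdot \tau_b = \tau_{a+b}$. The augmentation ideal $\operatorname{Aug}(\mathbb{Z}[A])$ is the ideal of $\mathbb{Z}[A]$ generated by $\{\tau_a - 1 \mid a \in A\}$. For an ideal $I$, $I^0 = \mathbb{Z}[A]$ and $I^n$ is the ideal generated by all products $i_1\cdots i_n$ with $i_1,\ldots,i_n \in I$. For an abelian group $B$, the ring $\mathbb{Z}[A]$ acts on the group $B^A$ of all functions $f : A \to B$ by $((\sum_{a} z_a \tau_a) * f)(x) = \sum_{a} z_a f(x+a)$. For an ideal $J$, $J * f = 0$ means $j * f = 0$ for all $j \in J$. Functional degree: for a function $f : A \to B$ between abelian groups and $I := \operatorname{Aug}(\mathbb{Z}[A])$, $\operatorname{Fdeg}(f) := \min\{ n \in \mathbb{N}_0 \mid I^{n+1} * f = 0\}$, with $\operatorname{Fdeg}(f) =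 \infty$ if no such $n$ exists. Here the functional degree of $f_i$ is taken with respect to the groups $A^N$ (domain) and $A$ (codomain). *)

theory Defs
  imports
    "HOL-Library.Poly_Mapping"
    "HOL-Library.Extended_Nat"
    "HOL-Computational_Algebra.Primes"
    "HOL-Analysis.Finite_Cartesian_Product"
begin

text \<open>
  The integral group ring of the abelian group \<open>'a\<close> is the type \<open>'a \<Rightarrow>\<^sub>0 int\<close> of finitely
  supported functions, whose multiplication in \<open>Poly_Mapping\<close> is convolution.
\<close>

definition tau :: "'a::ab_group_add \<Rightarrow> ('a \<Rightarrow>\<^sub>0 int)"
  where "tau a = Poly_Mapping.single a 1"

lemma tau_mult: "tau a * tau b = tau (a + b)"
  by (simp add: tau_def mult_single)

lemma tau_zero: "tau 0 = 1"
  by (simp add: tau_def)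

lemma group_ring_expansion:
  "F = (\<Sum>a\<in>Poly_Mapping.keys F. of_int (Poly_Mapping.lookup F a) * tau a)"
proof (rule poly_mapping_eqI)
  fix b
  have "of_int z * tau a = Poly_Mapping.single a z" for z :: int and a :: 'a
    by (simp add: tau_def mult_single flip: single_of_int)
  then have "Poly_Mapping.lookup (\<Sum>a\<in>Poly_Mapping.keys F. of_int (Poly_Mapping.lookup F a) * tau a) b
      = (\<Sum>a\<in>Poly_Mapping.keys F. if a = b then Poly_Mapping.lookup F a else 0)"
    by (simp add: lookup_sum lookup_single when_def)
  also have "\<dots> = Poly_Mapping.lookup F b"
    by (simp add: in_keys_iff)
  finally show "Poly_Mapping.lookup F b
      = Poly_Mapping.lookup (\<Sum>a\<in>Poly_Mapping.keys F. of_int (Poly_Mapping.lookup F a) * tau a) b"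
    by simp
qed

text \<open>A commutative ring is a module over itself; its submodules are the ideals.\<close>

lemma module_times: "module ((*) :: 'a::comm_ring_1 \<Rightarrow> 'a \<Rightarrow> 'a)"
  by unfold_locales (simp_all add: algebra_simps)

definition ideal_gen :: "'a::comm_ring_1 set \<Rightarrow> 'a set"
  where "ideal_gen S = module.span (*) S"

text \<open>For \<open>n = 0\<close> the only product is the empty one, so the zeroth power is the whole ring.\<close>

definition ideal_pow :: "'a::comm_ring_1 set \<Rightarrow> nat \<Rightarrow> 'a set"
  where "ideal_pow I n = ideal_gen {\<Prod>k=1..n. g k | g. \<forall>k\<in>{1..n}. g k \<in> I}"

lemma ideal_pow_0: "ideal_pow I 0 = UNIV"
proof -
  interpret module "(*) :: 'a::comm_ring_1 \<Rightarrow> 'a \<Rightarrow> 'a"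
    by (rule module_times)
  have "x \<in> span {1}" for x :: 'a
    using span_scale[OF span_base[of 1 "{1}"], of x] by simp
  then show ?thesis
    by (auto simp: ideal_pow_def ideal_gen_def)
qed

definition Aug :: "('a::ab_group_add \<Rightarrow>\<^sub>0 int) set"
  where "Aug = ideal_gen (range (\<lambda>a. tau a - 1))"

text \<open>The integer multiple \<open>z \<cdot> b\<close>; at most one of the two sums is nonempty.\<close>

definition int_mult :: "int \<Rightarrow> 'b::ab_group_add \<Rightarrow> 'b"
  where "int_mult z b = (\<Sum>_<nat z. b) - (\<Sum>_<nat (- z). b)"

definition act :: "('a::ab_group_add \<Rightarrow>\<^sub>0 int) \<Rightarrow> ('a \<Rightarrow> 'b::ab_group_add) \<Rightarrow> 'a \<Rightarrow> 'b"
  where "act F f = (\<lambda>x. \<Sum>a\<in>Poly_Mapping.keys F. int_mult (Poly_Mapping.lookup F a) (f (x + a)))"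

definition annihilates :: "('a::ab_group_add \<Rightarrow>\<^sub>0 int) set \<Rightarrow> ('a \<Rightarrow> 'b::ab_group_add) \<Rightarrow> bool"
  where "annihilates J f \<longleftrightarrow> (\<forall>j\<in>J. act j f = (\<lambda>_. 0))"

definition Fdeg :: "('a::ab_group_add \<Rightarrow> 'b::ab_group_add) \<Rightarrow> enat"
  where "Fdeg f =
    (if \<exists>n. annihilates (ideal_pow Aug (n + 1)) f
     then enat (LEAST n. annihilates (ideal_pow Aug (n + 1)) f)
     else \<infinity>)"

end

theory Submission imports Defs begin

text \<open>
  Let \<open>D\<close> be maximal such that the \<open>D\<close>-th power of the augmentation ideal \<open>I\<close> of \<open>\<int>[A]\<close> is nonzero
  modulo \<open>p\<close>; it exists because \<open>A\<close> is a \<open>p\<close>-group, and \<open>D \<ge> 1\<close> because \<open>A\<close> is nontrivial. If \<open>f\<close> has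
  functional degree at most \<open>m\<close>, then the differences of order \<open>D m + 1\<close> of \<open>x \<mapsto> \<tau>\<^bsub>f(x)\<^esub>\<close> lie in
  \<open>I\<^bsup>D+1\<^esup> + p\<int>[A] = p\<int>[A]\<close>: for \<open>m \<ge> 1\<close> give every difference the weight \<open>1/m\<close> and use the Leibniz rule together
  with \<open>\<Delta>\<^sub>a \<tau>\<^sub>f = \<tau>\<^sub>f (\<tau>\<^bsub>\<Delta>\<^sub>a f\<^esub> - 1)\<close>, where \<open>\<Delta>\<^sub>a f\<close> has smaller degree. Taking the coefficient of
  \<open>\<tau>\<^sub>0\<close> and multiplying over \<open>i\<close>, the indicator function of the zero set has degree at most
  \<open>D \<Sum>\<^sub>i Fdeg f\<^sub>i < D N\<close> modulo \<open>p\<close>. The indicator function of a single point has degree at least \<open>D N\<close>,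
  since the \<open>N\<close>-th tensor power of a product of \<open>D\<close> generators \<open>\<tau>\<^sub>a - 1\<close> that is nonzero modulo \<open>p\<close> is a
  nonzero product of \<open>D N\<close> such generators in \<open>\<int>[A\<^sup>N]\<close>.
\<close>

section \<open>Products of augmentation generators and their coefficients\<close>

definition aug_prod :: "'a::ab_group_add list \<Rightarrow> 'a \<Rightarrow>\<^sub>0 int"
  where "aug_prod L = (\<Prod>a\<leftarrow>L. tau a - 1)"

lemma aug_prod_simps [simp]:
  "aug_prod [] = 1"
  "aug_prod (a # L) = (tau a - 1) * aug_prod L"
  "aug_prod (L @ M) = aug_prod L * aug_prod M"
  by (simp_all add: aug_prod_def)

lemma lookup_tau: "Poly_Mapping.lookup (tau a) b = (if a = b then 1 else 0)"
  by (simp add: tau_def lookup_single)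

lemma lookup_times_tau:
  "Poly_Mapping.lookup (F * tau a) b = Poly_Mapping.lookup F (b - a)"
proof -
  have single: "of_int z * tau c = Poly_Mapping.single c z" for z :: int and c :: 'a
    by (simp add: tau_def mult_single flip: single_of_int)
  have "F * tau a = (\<Sum>c\<in>Poly_Mapping.keys F. of_int (Poly_Mapping.lookup F c) * tau c) * tau a"
    using group_ring_expansion[of F] by simp
  also have "\<dots> = (\<Sum>c\<in>Poly_Mapping.keys F. Poly_Mapping.single (c + a) (Poly_Mapping.lookup F c))"
    by (simp add: single sum_distrib_right) (simp add: tau_def mult_single)
  also have "Poly_Mapping.lookup \<dots> b =
      (\<Sum>c\<in>Poly_Mapping.keys F. if c = b - a then Poly_Mapping.lookup F c else 0)"
    by (auto simp: lookup_sum lookup_single when_def algebra_simps intro!: sum.cong)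
  also have "\<dots> = Poly_Mapping.lookup F (b - a)"
    by (simp add: in_keys_iff)
  finally show ?thesis .
qed

lemma lookup_of_int_times:
  fixes F :: "'a::ab_group_add \<Rightarrow>\<^sub>0 int"
  shows "Poly_Mapping.lookup (of_int z * F) b = z * Poly_Mapping.lookup F b"
proof -
  have "of_int z * F = (\<Sum>c\<in>Poly_Mapping.keys F.
      Poly_Mapping.single c (z * Poly_Mapping.lookup F c))"
    by (subst group_ring_expansion[of F])
      (simp add: sum_distrib_left tau_def mult_single flip: single_of_int)
  then show ?thesis
    by (simp add: lookup_sum lookup_single when_def in_keys_iff)
qed

text \<open>Working modulo \<open>p\<close> means divisibility by \<open>of_nat p\<close> in the
  integral group ring throughout; this reads it off coefficientwise.\<close>

lemma of_nat_dvd_iff_lookup: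
  "(of_nat p :: 'a::ab_group_add \<Rightarrow>\<^sub>0 int) dvd F \<longleftrightarrow> (\<forall>b. int p dvd Poly_Mapping.lookup F b)"
proof
  assume "of_nat p dvd F"
  then obtain G where "F = of_int (int p) * G"
    by (auto elim: dvdE)
  then show "\<forall>b. int p dvd Poly_Mapping.lookup F b"
    by (simp only: lookup_of_int_times) simp
next
  assume *: "\<forall>b. int p dvd Poly_Mapping.lookup F b"
  have "(of_nat p :: 'a \<Rightarrow>\<^sub>0 int) dvd of_int (Poly_Mapping.lookup F b)" for b
    using *[rule_format, of b] by (metis dvd_def of_int_mult of_int_of_nat_eq)
  then have "of_nat p dvd (\<Sum>a\<in>Poly_Mapping.keys F. of_int (Poly_Mapping.lookup F a) * tau a)"
    by (intro dvd_sum dvd_mult2)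
  then show "of_nat p dvd F"
    using group_ring_expansion[of F] by simp
qed

section \<open>Integer multiples, the group ring action and iterated differences\<close>

text \<open>Allowing any representation as a difference of naturals spares the proof of additivity a
  case distinction on signs.\<close>

lemma int_mult_diff_of_nat:
  "int_mult (int m - int n) b = (\<Sum>_<m. b) - (\<Sum>_<n. b)"
proof -
  have add: "(\<Sum>_<i + j. b) = (\<Sum>_<i. b) + (\<Sum>_<j. b)" for i j :: nat
    by (induction j) (simp_all add: algebra_simps)
  show ?thesis
  proof (cases "n \<le> m")
    case True
    then obtain k where "m = n + k"
      using le_Suc_ex by blast
    then show ?thesis
      by (simp add: int_mult_def add)
  next
    case False
    then obtain k where "n = m + k"
      using le_Suc_ex[of m n] by auto
    then show ?thesis
      by (simp add: int_mult_def add)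
  qed
qed

lemma int_mult_add: "int_mult (z + w) b = int_mult z b + int_mult w b"
proof -
  have add: "(\<Sum>_<i + j. b) = (\<Sum>_<i. b) + (\<Sum>_<j. b)" for i j :: nat
    by (induction j) (simp_all add: algebra_simps)
  obtain i j where z: "z = int i - int j"
    using int_diff_cases by blast
  obtain k l where w: "w = int k - int l"
    using int_diff_cases by blast
  have "z + w = int (i + k) - int (j + l)"
    by (simp add: z w)
  then show ?thesis
    by (simp only: int_mult_diff_of_nat z w add) simp
qed

lemma int_mult_0 [simp]: "int_mult 0 b = 0"
  and int_mult_1 [simp]: "int_mult 1 b = b"
  by (simp_all add: int_mult_def)

lemma int_mult_diff: "int_mult (z - w) b = int_mult z b - int_mult w b"
  using int_mult_add[of "z - w" w b] by (simp add: algebra_simps)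

lemma int_mult_int: "int_mult z (b :: int) = z * b"
  by (simp add: int_mult_def flip: left_diff_distrib)

lemma act_eq_sum_UNIV:
  "act F f x = (\<Sum>a\<in>(UNIV :: 'a::{finite, ab_group_add} set).
     int_mult (Poly_Mapping.lookup F a) (f (x + a)))"
  unfolding act_def by (rule sum.mono_neutral_left) (auto simp: in_keys_iff)

text \<open>A generator acts as a difference operator: substituting \<open>b + a\<close> for
  \<open>b\<close> moves the shift from the coefficients to the function.\<close>

lemma act_times_tau_minus_1:
  fixes f :: "'a::{finite, ab_group_add} \<Rightarrow> 'b::ab_group_add"
  shows "act (F * (tau a - 1)) f = act F (\<lambda>x. f (x + a) - f x)"
proof
  fix x
  have int_mult_right: "int_mult z (b - c) = int_mult z b - int_mult z c" for z and b c :: 'b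
    by (simp add: int_mult_def sum_subtractf)
  have "act (F * (tau a - 1)) f x =
      (\<Sum>b\<in>UNIV. int_mult (Poly_Mapping.lookup F (b - a)) (f (x + b)))
      - (\<Sum>b\<in>UNIV. int_mult (Poly_Mapping.lookup F b) (f (x + b)))"
    by (simp add: act_eq_sum_UNIV algebra_simps lookup_minus lookup_times_tau int_mult_diff
        sum_subtractf)
  also have "(\<Sum>b\<in>UNIV. int_mult (Poly_Mapping.lookup F (b - a)) (f (x + b))) =
      (\<Sum>b\<in>UNIV. int_mult (Poly_Mapping.lookup F b) (f (x + b + a)))"
    by (rule sum.reindex_bij_witness[of _ "\<lambda>b. b + a" "\<lambda>b. b - a"]) (simp_all add: algebra_simps)
  finally show "act (F * (tau a - 1)) f x = act F (\<lambda>x. f (x + a) - f x) x"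
    by (simp add: act_eq_sum_UNIV int_mult_right sum_subtractf algebra_simps)
qed

text \<open>For \<open>S = {0}\<close> and \<open>n = d + 1\<close> this says that \<open>f\<close> has functional degree at most \<open>d\<close>;
  taking a subgroup for \<open>S\<close> amounts to composing \<open>f\<close> with the quotient map.\<close>

primrec diffs_in :: "'b set \<Rightarrow> nat \<Rightarrow> ('a::ab_group_add \<Rightarrow> 'b::ab_group_add) \<Rightarrow> bool"
  where
    "diffs_in S 0 f \<longleftrightarrow> (\<forall>x. f x \<in> S)"
  | "diffs_in S (Suc n) f \<longleftrightarrow> (\<forall>a. diffs_in S n (\<lambda>x. f (x + a) - f x))"

lemma diffs_in_iff_act:
  fixes f :: "'a::{finite, ab_group_add} \<Rightarrow> 'b::ab_group_add"
  shows "diffs_in S n f \<longleftrightarrow> (\<forall>L. length L = n \<longrightarrow> (\<forall>x. act (aug_prod L) f x \<in> S))"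
proof (induction n arbitrary: f)
  case 0
  have "act 1 f = f"
    using keys_one by (auto simp: act_def fun_eq_iff)
  then show ?case
    by simp
next
  case (Suc n)
  have "act (aug_prod (a # L)) f = act (aug_prod L) (\<lambda>x. f (x + a) - f x)" for a L
    by (simp only: aug_prod_simps mult.commute[of "tau a - 1"] act_times_tau_minus_1)
  moreover have "(\<forall>L. length L = Suc n \<longrightarrow> P L) \<longleftrightarrow> (\<forall>a L. length L = n \<longrightarrow> P (a # L))"
    for P :: "'a list \<Rightarrow> bool"
    by (auto simp: length_Suc_conv)
  ultimately show ?case
    by (simp only: diffs_in.simps Suc.IH)
qed

text \<open>A product of \<open>n\<close> elements \<open>tau a - 1\<close> is among the generators
  of the \<open>n\<close>-th power of \<open>Aug\<close>. List positions start at 0 and the factors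
  of \<open>ideal_pow\<close> at 1, hence the shift \<open>k - 1\<close>.\<close>

lemma annihilates_imp_diffs_in:
  fixes f :: "'a::{finite, ab_group_add} \<Rightarrow> 'b::ab_group_add"
  assumes "annihilates (ideal_pow Aug n) f"
  shows "diffs_in {0} n f"
  unfolding diffs_in_iff_act
proof (intro allI impI)
  fix L :: "'a list" and x
  assume len: "length L = n"
  interpret module "(*) :: ('a \<Rightarrow>\<^sub>0 int) \<Rightarrow> _ \<Rightarrow> _"
    by (rule module_times)
  have "aug_prod L = (\<Prod>i<n. tau (L ! i) - 1)"
    by (simp add: aug_prod_def prod.list_conv_set_nth len atLeast0LessThan)
  also have "\<dots> = (\<Prod>k=1..n. tau (L ! (k - 1)) - 1)"
    by (rule prod.reindex_bij_witness[of _ "\<lambda>k. k - 1" Suc]) auto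
  finally have "aug_prod L = (\<Prod>k=1..n. tau (L ! (k - 1)) - 1)" .
  moreover have "tau a - 1 \<in> (Aug :: ('a \<Rightarrow>\<^sub>0 int) set)" for a
    unfolding Aug_def ideal_gen_def by (intro span_base) simp
  ultimately have "aug_prod L \<in> ideal_pow Aug n"
    unfolding ideal_pow_def ideal_gen_def
    by (intro span_base CollectI exI[of _ "\<lambda>k. tau (L ! (k - 1)) - 1"]) simp
  then show "act (aug_prod L) f x \<in> {0}"
    using assms by (simp add: annihilates_def)
qed

lemma Fdeg_imp_diffs_in:
  fixes f :: "'a::{finite, ab_group_add} \<Rightarrow> 'b::ab_group_add"
  assumes "Fdeg f = enat d"
  shows "diffs_in {0} (d + 1) f"
proof -
  have ex: "\<exists>n. annihilates (ideal_pow Aug (n + 1)) f"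
    using assms by (auto simp: Fdeg_def split: if_splits)
  then have "d = (LEAST n. annihilates (ideal_pow Aug (n + 1)) f)"
    using assms by (simp add: Fdeg_def)
  with LeastI_ex[OF ex] have "annihilates (ideal_pow Aug (d + 1)) f"
    by simp
  then show ?thesis
    by (rule annihilates_imp_diffs_in)
qed

text \<open>Additive maps commute with differences. This serves both for taking a coefficient and,
  with the identity, for enlarging \<open>S\<close>.\<close>

lemma diffs_in_image:
  assumes "diffs_in S n f"
    and "\<And>y. y \<in> S \<Longrightarrow> \<phi> y \<in> T"
    and "\<And>y z. \<phi> (y - z) = \<phi> y - \<phi> z"
  shows "diffs_in T n (\<lambda>x. \<phi> (f x))"
  using assms(1)
proof (induction n arbitrary: f)
  case (Suc n)
  then have "diffs_in T n (\<lambda>x. \<phi> (f (x + a) - f x))" for a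
    by simp
  then show ?case
    by (simp add: assms(3))
qed (simp add: assms(2))

section \<open>Degrees of sums and products modulo a ring element\<close>

lemma diffs_in_dvd_add:
  fixes c :: "'r::comm_ring_1"
  assumes "diffs_in {x. c dvd x} n g" and "diffs_in {x. c dvd x} n h"
  shows "diffs_in {x. c dvd x} n (\<lambda>x. g x + h x)"
  using assms
proof (induction n arbitrary: g h)
  case (Suc n)
  have "diffs_in {x. c dvd x} n (\<lambda>x. (g (x + a) - g x) + (h (x + a) - h x))" for a
    using Suc.prems by (intro Suc.IH) simp_all
  then show ?case
    by (simp add: algebra_simps)
qed simp

lemma diffs_in_dvd_mono:
  fixes c :: "'r::comm_ring_1"
  assumes "diffs_in {x. c dvd x} m g" and "m \<le> n"
  shows "diffs_in {x. c dvd x} n g"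
proof -
  have step: "diffs_in {x. c dvd x} (Suc n) h" if "diffs_in {x. c dvd x} n h"
    for n and h :: "'a \<Rightarrow> 'r"
    using that
  proof (induction n arbitrary: h)
    case (Suc n)
    then have "diffs_in {x. c dvd x} n (\<lambda>x. h (x + a) - h x)" for a
      by simp
    from Suc.IH[OF this] show ?case
      by (subst diffs_in.simps) blast
  qed simp
  show ?thesis
    using assms(2,1) by (induction rule: dec_induct) (blast intro: step)+
qed

text \<open>Degrees add under multiplication. Since \<open>m\<close> stands for degree
  \<open>m - 1\<close>, the product needs only order \<open>m + n - 1\<close>; for
  \<open>k = 0\<close> one factor is therefore already divisible by \<open>c\<close>.\<close>

lemma diffs_in_dvd_mult:
  fixes c :: "'r::comm_ring_1"
  assumes "diffs_in {x. c dvd x} m g" and "diffs_in {x. c dvd x} n h" and "m + n \<le> k + 1"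
  shows "diffs_in {x. c dvd x} k (\<lambda>x. g x * h x)"
  using assms
proof (induction k arbitrary: m n g h)
  case 0
  then have "m = 0 \<or> n = 0"
    by linarith
  with 0 show ?case
    by auto
next
  case (Suc k)
  let ?S = "{x. c dvd x}"
  show ?case
  proof (cases "m = 0 \<or> n = 0")
    case True
    then have "diffs_in ?S 0 (\<lambda>x. g x * h x)"
      using Suc.prems by auto
    then show ?thesis
      by (rule diffs_in_dvd_mono) simp
  next
    case False
    then obtain m' n' where mn: "m = Suc m'" "n = Suc n'"
      by (metis not0_implies_Suc)
    have "diffs_in ?S k (\<lambda>x. g (x + a) * h (x + a) - g x * h x)" for a
    proof -
      define g' h' where "g' = (\<lambda>x. g (x + a) - g x)" and "h' = (\<lambda>x. h (x + a) - h x)"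
      have g': "diffs_in ?S m' g'" and h': "diffs_in ?S n' h'"
        using Suc.prems mn by (simp_all add: g'_def h'_def)
      \<comment> \<open>The Leibniz rule for differences has a third term; in each summand
        \<open>m + n\<close> drops by at least one.\<close>
      have "diffs_in ?S k (\<lambda>x. (g' x * h x + g x * h' x) + g' x * h' x)"
        using Suc.prems mn
        by (intro diffs_in_dvd_add Suc.IH[OF g' Suc.prems(2)] Suc.IH[OF Suc.prems(1) h']
            Suc.IH[OF g' h']) simp_all
      then show ?thesis
        by (simp add: g'_def h'_def algebra_simps)
    qed
    then show ?thesis
      by simp
  qed
qed

lemma diffs_in_dvd_prod:
  fixes c :: "'r::comm_ring_1"
  assumes "finite I" and "\<And>i. i \<in> I \<Longrightarrow> diffs_in {x. c dvd x} (m i + 1) (g i)"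
  shows "diffs_in {x. c dvd x} (sum m I + 1) (\<lambda>x. \<Prod>i\<in>I. g i x)"
  using assms
proof (induction I rule: finite_induct)
  case (insert i I)
  then have "diffs_in {x. c dvd x} (sum m (insert i I) + 1) (\<lambda>x. g i x * (\<Prod>i\<in>I. g i x))"
    by (intro diffs_in_dvd_mult[of c "m i + 1" _ "sum m I + 1"]) simp_all
  with insert show ?case
    by simp
qed simp

section \<open>Filtered rings and the weights of functions into them\<close>

text \<open>Each \<open>J n\<close> is an ideal, by \<open>mult_mem\<close> with one index 0 and
  \<open>zeroth\<close>.\<close>

locale filtration =
  fixes J :: "nat \<Rightarrow> 'r::comm_ring_1 set"
  assumes zeroth: "J 0 = UNIV"
    and zero_mem: "0 \<in> J n"
    and add_mem: "x \<in> J n \<Longrightarrow> y \<in> J n \<Longrightarrow> x + y \<in> J n"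
    and mult_mem: "x \<in> J i \<Longrightarrow> y \<in> J j \<Longrightarrow> x * y \<in> J (i + j)"
    and antimono: "i \<le> j \<Longrightarrow> J j \<subseteq> J i"
begin

text \<open>The truncation at \<open>K\<close> is what the induction in \<open>filtered_hom\<close> below runs on.\<close>

primrec filtered :: "nat \<Rightarrow> nat \<Rightarrow> ('x::ab_group_add \<Rightarrow> 'r) \<Rightarrow> bool"
  where
    "filtered 0 w h \<longleftrightarrow> True"
  | "filtered (Suc K) w h \<longleftrightarrow>
      (\<forall>x. h x \<in> J w) \<and> (\<forall>a. filtered K (w + 1) (\<lambda>x. h (x + a) - h x))"

lemma filtered_zero: "filtered K w (\<lambda>_. 0)"
  by (induction K arbitrary: w) (simp_all add: zero_mem)

lemma filtered_const: "filtered K 0 (\<lambda>_. c)"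
  by (cases K) (simp_all add: zeroth filtered_zero)

lemma filtered_antimono: "filtered K v h \<Longrightarrow> w \<le> v \<Longrightarrow> filtered K w h"
proof (induction K arbitrary: v w h)
  case (Suc K)
  then have "filtered K (v + 1) (\<lambda>x. h (x + a) - h x)" for a
    by simp
  then have "filtered K (w + 1) (\<lambda>x. h (x + a) - h x)" for a
    by (rule Suc.IH) (simp add: Suc.prems)
  with Suc.prems antimono[of w v] show ?case
    by auto
qed simp

lemma filtered_pred: "filtered (Suc K) w h \<Longrightarrow> filtered K w h"
proof (induction K arbitrary: w h)
  case (Suc K)
  then have "(\<forall>x. h x \<in> J w) \<and> (\<forall>a. filtered (Suc K) (w + 1) (\<lambda>x. h (x + a) - h x))"
    by (subst (asm) filtered.simps)
  then have "\<forall>x. h x \<in> J w" and "filtered (Suc K) (w + 1) (\<lambda>x. h (x + a) - h x)" for a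
    by blast+
  then show ?case
    by (subst filtered.simps) (blast intro: Suc.IH)
qed simp

lemma filtered_add:
  "filtered K w g \<Longrightarrow> filtered K w h \<Longrightarrow> filtered K w (\<lambda>x. g x + h x)"
proof (induction K arbitrary: w g h)
  case (Suc K)
  have "filtered K (w + 1) (\<lambda>x. (g (x + a) - g x) + (h (x + a) - h x))" for a
    using Suc.prems by (intro Suc.IH) simp_all
  with Suc.prems show ?case
    by (simp add: add_mem algebra_simps)
qed simp

text \<open>The Leibniz rule again: a difference gains weight 1 in at least one factor, so each of
  the three summands has weight at least \<open>w + v + 1\<close>.\<close>

lemma filtered_mult:
  "filtered K w g \<Longrightarrow> filtered K v h \<Longrightarrow> filtered K (w + v) (\<lambda>x. g x * h x)"
proof (induction K arbitrary: w v g h)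
  case (Suc K)
  have "filtered K (w + v + 1) (\<lambda>x. g (x + a) * h (x + a) - g x * h x)" for a
  proof -
    define g' h' where "g' = (\<lambda>x. g (x + a) - g x)" and "h' = (\<lambda>x. h (x + a) - h x)"
    have g': "filtered K (w + 1) g'" and h': "filtered K (v + 1) h'"
      using Suc.prems by (simp_all add: g'_def h'_def)
    have g: "filtered K w g" and h: "filtered K v h"
      using Suc.prems filtered_pred by blast+
    have "filtered K (w + v + 1) (\<lambda>x. (g' x * h x + g x * h' x) + g' x * h' x)"
      using Suc.IH[OF g' h] Suc.IH[OF g h'] Suc.IH[OF g' h']
      by (intro filtered_add) (auto simp: add_ac elim: filtered_antimono)
    then show ?thesis
      by (simp add: g'_def h'_def algebra_simps)
  qed
  with Suc.prems show ?case
    by (simp add: mult_mem)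
qed simp

text \<open>Truncation at \<open>Suc n\<close> sees the differences of orders 0 to \<open>n\<close>,
  and each order raises the weight by one.\<close>

lemma filtered_imp_diffs_in: "filtered (Suc n) w h \<Longrightarrow> diffs_in (J (w + n)) n h"
proof (induction n arbitrary: w h)
  case (Suc n)
  then have "diffs_in (J ((w + 1) + n)) n (\<lambda>x. h (x + a) - h x)" for a
    by (intro Suc.IH) simp
  then show ?case
    by simp
qed simp

text \<open>A difference of \<tau> o f is \<tau> o f times \<tau> o g - 1, where g is a difference
  of f. Passing from f to g lowers \<open>e\<close> by one, which supplies the gain in
  weight.\<close>

lemma filtered_hom:
  fixes f :: "'x::ab_group_add \<Rightarrow> 'a::ab_group_add" and \<tau> :: "'a \<Rightarrow> 'r"
  assumes hom: "\<And>a b. \<tau> (a + b) = \<tau> a * \<tau> b" and one: "\<tau> 0 = 1"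
    and mem: "\<And>a. \<tau> a - 1 \<in> J m"
    and "diffs_in {0} e f" and "e \<le> m + 1"
  shows "filtered K (m + 1 - e) (\<lambda>x. \<tau> (f x) - 1)"
  using assms(4,5)
proof (induction K arbitrary: e f)
  case (Suc K)
  show ?case
  proof (cases e)
    case 0
    with Suc.prems have "f = (\<lambda>_. 0)"
      by auto
    then show ?thesis
      by (simp add: one zero_mem filtered_zero)
  next
    case e: (Suc d)
    \<comment> \<open>The factor \<tau> o f recurs in its own difference. Differences are inspected
      only up to truncation \<open>K\<close>, so the induction hypothesis for the same
      \<open>f\<close> and \<open>e\<close> breaks the circle.\<close>
    have "filtered K (m + 1 - e) (\<lambda>x. \<tau> (f x) - 1)"
      using Suc by blast
    then have "filtered K 0 (\<lambda>x. (\<tau> (f x) - 1) + 1)"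
      by (intro filtered_add filtered_const) (auto elim: filtered_antimono)
    then have \<tau>f: "filtered K 0 (\<lambda>x. \<tau> (f x))"
      by simp
    have "filtered K (m + 1 - e + 1) (\<lambda>x. (\<tau> (f (x + a)) - 1) - (\<tau> (f x) - 1))" for a
    proof -
      have "filtered K (m + 1 - d) (\<lambda>x. \<tau> (f (x + a) - f x) - 1)"
        using Suc.prems e by (intro Suc.IH) simp_all
      from filtered_mult[OF \<tau>f this]
      have "filtered K (m + 1 - d) (\<lambda>x. \<tau> (f x) * (\<tau> (f (x + a) - f x) - 1))"
        by simp
      moreover have "\<tau> (f x) * (\<tau> (f (x + a) - f x) - 1) = (\<tau> (f (x + a)) - 1) - (\<tau> (f x) - 1)" for x
        by (simp add: right_diff_distrib flip: hom)
      moreover have "m + 1 - d = m + 1 - e + 1"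
        using Suc.prems e by simp
      ultimately show ?thesis
        by simp
    qed
    moreover have "\<tau> a - 1 \<in> J (m + 1 - e)" for a
      using mem[of a] antimono[of "m + 1 - e" m] e by auto
    ultimately show ?thesis
      by simp
  qed
qed simp

text \<open>The new ideal at \<open>k\<close> is \<open>J\<close> at k/m rounded up, so old weight
  1/m becomes new weight 1 and all weights stay natural numbers.\<close>

lemma filtration_rescale:
  assumes "m > 0"
  shows "filtration (\<lambda>k. {x. \<exists>u. k \<le> m * u \<and> x \<in> J u})"
proof
  show "{x. \<exists>u. 0 \<le> m * u \<and> x \<in> J u} = UNIV"
    using zeroth by auto
  show "0 \<in> {x. \<exists>u. n \<le> m * u \<and> x \<in> J u}" for n
    using assms zero_mem by (auto intro!: exI[of _ n])
  show "x + y \<in> {x. \<exists>u. n \<le> m * u \<and> x \<in> J u}"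
    if "x \<in> {x. \<exists>u. n \<le> m * u \<and> x \<in> J u}" and "y \<in> {x. \<exists>u. n \<le> m * u \<and> x \<in> J u}" for x y n
  proof -
    from that obtain u v where "n \<le> m * u" "x \<in> J u" "n \<le> m * v" "y \<in> J v"
      by auto
    moreover have "J u \<subseteq> J (min u v)" "J v \<subseteq> J (min u v)"
      by (simp_all add: antimono)
    moreover have "n \<le> m * min u v"
      using calculation by (simp add: min_def)
    ultimately show ?thesis
      by (blast intro: add_mem)
  qed
  show "x * y \<in> {x. \<exists>u. i + j \<le> m * u \<and> x \<in> J u}"
    if "x \<in> {x. \<exists>u. i \<le> m * u \<and> x \<in> J u}" and "y \<in> {x. \<exists>u. j \<le> m * u \<and> x \<in> J u}" for x y i j
  proof -
    from that obtain u v where "i \<le> m * u" "x \<in> J u" "j \<le> m * v" "y \<in> J v"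
      by auto
    then show ?thesis
      by (auto simp: distrib_left intro!: exI[of _ "u + v"] mult_mem)
  qed
  show "{x. \<exists>u. j \<le> m * u \<and> x \<in> J u} \<subseteq> {x. \<exists>u. i \<le> m * u \<and> x \<in> J u}" if "i \<le> j" for i j
    using that by (auto intro: order_trans)
qed

theorem diffs_in_hom:
  fixes f :: "'x::ab_group_add \<Rightarrow> 'a::ab_group_add" and \<tau> :: "'a \<Rightarrow> 'r"
  assumes hom: "\<And>a b. \<tau> (a + b) = \<tau> a * \<tau> b" and one: "\<tau> 0 = 1"
    and mem: "\<And>a. \<tau> a - 1 \<in> J 1"
    and f: "diffs_in {0} (m + 1) f"
  shows "diffs_in (J (D + 1)) (D * m + 1) (\<lambda>x. \<tau> (f x))"
proof (cases "m = 0")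
  case True
  with f have "f (x + a) = f x" for x a
    by simp
  with True show ?thesis
    by (simp add: zero_mem)
next
  case False
  define J' where "J' = (\<lambda>k. {x. \<exists>u. k \<le> m * u \<and> x \<in> J u})"
  interpret resc: filtration J'
    unfolding J'_def using False by (intro filtration_rescale) simp
  let ?n = "D * m + 1"
  have "\<tau> a - 1 \<in> J' m" for a
    using mem by (auto simp: J'_def intro!: exI[of _ 1])
  \<comment> \<open>The largest admissible order \<open>e = m + 1\<close> gives weight 0, so adding
    back the constant 1 costs nothing.\<close>
  then have "resc.filtered (Suc ?n) (m + 1 - (m + 1)) (\<lambda>x. \<tau> (f x) - 1)"
    by (intro resc.filtered_hom hom one f) simp_all
  then have "resc.filtered (Suc ?n) 0 (\<lambda>x. (\<tau> (f x) - 1) + 1)"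
    by (intro resc.filtered_add resc.filtered_const) simp
  then have "diffs_in (J' ?n) ?n (\<lambda>x. \<tau> (f x))"
    using resc.filtered_imp_diffs_in[of ?n 0] by simp
  \<comment> \<open>Here the summand 1 in \<open>?n\<close> matters: \<open>D * m < m * u\<close>
    forces \<open>u\<close> past \<open>D\<close>.\<close>
  moreover have "J' ?n \<subseteq> J (D + 1)"
  proof
    fix x assume "x \<in> J' ?n"
    then obtain u where u: "?n \<le> m * u" "x \<in> J u"
      by (auto simp: J'_def)
    then have "D * m < u * m"
      by (subst mult.commute[of u m]) linarith
    then have "D + 1 \<le> u"
      by (simp only: mult_less_cancel2) simp
    with u antimono show "x \<in> J (D + 1)"
      by blast
  qed
  ultimately show ?thesis
    by (auto intro: diffs_in_image[where \<phi> = "\<lambda>y. y"])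
qed

end

section \<open>The augmentation filtration modulo \<open>p\<close>\<close>

definition aug_filt :: "nat \<Rightarrow> nat \<Rightarrow> ('a::ab_group_add \<Rightarrow>\<^sub>0 int) set"
  where "aug_filt p n = ideal_gen (insert (of_nat p) (aug_prod ` {L. length L = n}))"

text \<open>Multiplicativity is checked on generators, one factor at a time: the elements whose
  product with a fixed one lands in the target ideal form a subspace, and products of generators
  multiply by concatenating lists.\<close>

lemma filtration_aug_filt: "filtration (aug_filt p :: nat \<Rightarrow> ('a::ab_group_add \<Rightarrow>\<^sub>0 int) set)"
proof
  interpret module "(*) :: ('a \<Rightarrow>\<^sub>0 int) \<Rightarrow> _ \<Rightarrow> _"
    by (rule module_times)
  let ?J = "aug_filt p :: nat \<Rightarrow> ('a \<Rightarrow>\<^sub>0 int) set"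
  have sub: "subspace (?J n)" for n
    by (simp add: aug_filt_def ideal_gen_def)
  have p_mem: "of_nat p \<in> ?J n" for n
    unfolding aug_filt_def ideal_gen_def by (rule span_base) simp
  have prod_mem: "aug_prod L \<in> ?J n" if "length L = n" for L n
    unfolding aug_filt_def ideal_gen_def using that by (intro span_base) simp
  have scale: "c * x \<in> ?J n" "x * c \<in> ?J n" if "x \<in> ?J n" for c x n
    using subspace_scale[OF sub that] by (simp_all add: mult.commute)
  have le: "?J n \<subseteq> T" if "subspace T" "of_nat p \<in> T" "\<And>L. length L = n \<Longrightarrow> aug_prod L \<in> T" for n T
    unfolding aug_filt_def ideal_gen_def using that by (intro span_minimal) auto
  show "?J 0 = UNIV"
    using scale(1)[OF prod_mem[of "[]"]] by auto
  show "0 \<in> ?J n" for n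
    by (rule subspace_0[OF sub])
  show "x + y \<in> ?J n" if "x \<in> ?J n" "y \<in> ?J n" for x y n
    using subspace_add[OF sub] that by blast
  have mult_prod: "x * aug_prod M \<in> ?J (i + length M)" if "x \<in> ?J i" for x i M
  proof -
    have "?J i \<subseteq> {x. x * aug_prod M \<in> ?J (i + length M)}"
    proof (rule le)
      show "subspace {x. x * aug_prod M \<in> ?J (i + length M)}"
        unfolding subspace_def mem_Collect_eq mult_zero_left distrib_right mult.assoc
        using subspace_0[OF sub] subspace_add[OF sub] scale(1) by blast
      show "of_nat p \<in> {x. x * aug_prod M \<in> ?J (i + length M)}"
        by (simp add: scale p_mem)
      show "aug_prod L \<in> {x. x * aug_prod M \<in> ?J (i + length M)}" if "length L = i" for L
        using prod_mem[of "L @ M"] that by simp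
    qed
    with that show ?thesis
      by blast
  qed
  show "x * y \<in> ?J (i + j)" if x: "x \<in> ?J i" and y: "y \<in> ?J j" for x y i j
  proof -
    have "?J j \<subseteq> {y. x * y \<in> ?J (i + j)}"
    proof (rule le)
      show "subspace {y. x * y \<in> ?J (i + j)}"
        unfolding subspace_def mem_Collect_eq mult_zero_right distrib_left mult.left_commute[of x]
        using subspace_0[OF sub] subspace_add[OF sub] scale(1) by blast
      show "of_nat p \<in> {y. x * y \<in> ?J (i + j)}"
        by (simp add: scale p_mem)
      show "aug_prod L \<in> {y. x * y \<in> ?J (i + j)}" if "length L = j" for L
        using mult_prod[OF x, of L] that by simp
    qed
    with y show ?thesis
      by blast
  qed
  have "?J (Suc n) \<subseteq> ?J n" for n
  proof (rule le[OF sub p_mem])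
    fix L :: "'a list"
    assume "length L = Suc n"
    then show "aug_prod L \<in> ?J n"
      by (cases L) (simp_all add: scale(1) prod_mem)
  qed
  then show "?J j \<subseteq> ?J i" if "i \<le> j" for i j
    using lift_Suc_antimono_le[of ?J] that by blast
qed

section \<open>Nilpotency of the augmentation ideal modulo \<open>p\<close>\<close>

lemma of_nat_dvd_one_plus_power_prime_power:
  fixes y :: "'r::comm_ring_1"
  assumes "prime p"
  shows "of_nat p dvd (1 + y) ^ (p ^ k) - (1 + y ^ (p ^ k))"
proof (induction k)
  case (Suc k)
  define u where "u = y ^ (p ^ k)"
  have "p > 0"
    using assms prime_gt_0_nat by blast
  have "(1 + u) ^ p = (\<Sum>i\<le>p. of_nat (p choose i) * u ^ i)"
    using binomial_ring[of u 1 p] by (simp add: add.commute)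
  also have "{..p} = insert 0 (insert p {1..<p})"
    using \<open>p > 0\<close> by auto
  also have "(\<Sum>i\<in>\<dots>. of_nat (p choose i) * u ^ i) =
      1 + u ^ p + (\<Sum>i=1..<p. of_nat (p choose i) * u ^ i)"
    using \<open>p > 0\<close> by simp
  finally have "(1 + u) ^ p - (1 + u ^ p) = (\<Sum>i=1..<p. of_nat (p choose i) * u ^ i)"
    by simp
  moreover have "of_nat p dvd (of_nat (p choose i) :: 'r)" if "i \<in> {1..<p}" for i
    using that dvd_choose_prime[of i p] assms by (auto elim!: dvdE)
  ultimately have "of_nat p dvd (1 + u) ^ p - (1 + u ^ p)"
    by (auto intro!: dvd_sum dvd_mult2)
  \<comment> \<open>A difference of two elements divides the difference of their \<open>p\<close>-th
    powers, so the induction hypothesis survives raising to the power \<open>p\<close>.\<close>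
  moreover have "of_nat p dvd ((1 + y) ^ (p ^ k)) ^ p - (1 + u) ^ p"
    using Suc.IH unfolding u_def by (simp add: power_diff_sumr2)
  ultimately have "of_nat p dvd (((1 + y) ^ (p ^ k)) ^ p - (1 + u) ^ p) + ((1 + u) ^ p - (1 + u ^ p))"
    by (rule dvd_add[rotated])
  then have "of_nat p dvd ((1 + y) ^ (p ^ k)) ^ p - (1 + u ^ p)"
    by (simp only: add_diff_eq diff_add_cancel)
  then show ?case
    unfolding u_def power_Suc2 power_mult .
qed simp

text \<open>Translation by \<open>a\<close> permutes the group, so the product of all
  \<open>tau x\<close> absorbs the power of \<open>tau a\<close>; that product is a unit and
  cancels.\<close>

lemma tau_power_card: "tau (a :: 'a::{finite, ab_group_add}) ^ CARD('a) = 1"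
proof -
  have prod_tau: "(\<Prod>x\<in>X. tau x) = tau (\<Sum>X)" for X :: "'a set"
    by (induction X rule: infinite_finite_induct) (simp_all add: tau_zero tau_mult)
  have "(\<Prod>x\<in>UNIV. tau (x + a)) = (\<Prod>x\<in>UNIV. tau (x :: 'a))"
    by (rule prod.reindex_bij_witness[of _ "\<lambda>x. x - a" "\<lambda>x. x + a"]) simp_all
  then have "tau (\<Sum>(UNIV :: 'a set)) * tau a ^ CARD('a) = tau (\<Sum>(UNIV :: 'a set))"
    by (simp add: prod.distrib prod_tau flip: tau_mult)
  then have "tau (- \<Sum>(UNIV :: 'a set)) * tau (\<Sum>(UNIV :: 'a set)) * tau a ^ CARD('a)
      = tau (- \<Sum>(UNIV :: 'a set)) * tau (\<Sum>(UNIV :: 'a set))"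
    by (simp add: mult.assoc)
  then show ?thesis
    by (simp add: tau_mult tau_zero)
qed

text \<open>By the pigeonhole principle some \<open>a\<close> occurs at least \<open>p ^ k\<close>
  times, and modulo \<open>p\<close> the power \<open>(tau a - 1) ^ (p ^ k)\<close> is
  \<open>tau a ^ CARD('a) - 1 = 0\<close>.\<close>

lemma aug_prod_nilpotent:
  fixes L :: "'a::{finite, ab_group_add} list"
  assumes "prime p" and q: "CARD('a) = p ^ k" and len: "length L = CARD('a) * p ^ k + 1"
  shows "of_nat p dvd aug_prod L"
proof -
  have "\<exists>a. count_list L a \<ge> p ^ k"
  proof (rule ccontr)
    assume "\<not> ?thesis"
    then have "(\<Sum>a\<in>set L. count_list L a) \<le> (\<Sum>a\<in>set L. p ^ k)"
      by (intro sum_mono) (simp add: not_le less_imp_le)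
    also have "\<dots> \<le> CARD('a) * p ^ k"
      by (simp add: card_mono)
    finally show False
      using len sum_count_set[of L "set L"] by simp
  qed
  then obtain a where a: "p ^ k \<le> count_list L a" ..
  have "(tau a - 1) ^ count_list L a dvd aug_prod L"
  proof (induction L)
    case (Cons b L)
    then show ?case
      by (auto intro: mult_dvd_mono dvd_mult)
  qed simp
  moreover have "(tau a - 1) ^ (p ^ k) dvd (tau a - 1) ^ count_list L a"
    using a by (rule le_imp_power_dvd)
  moreover have "of_nat p dvd (tau a - 1) ^ (p ^ k)"
    using of_nat_dvd_one_plus_power_prime_power[OF \<open>prime p\<close>, of "tau a - 1" k]
    by (simp add: tau_power_card flip: q)
  ultimately show ?thesis
    using dvd_trans by blast
qed

lemma ex_maximal_aug_prod:
  assumes "prime p" and "CARD('a) = p ^ k" and "CARD('a) > 1"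
  obtains D and L :: "'a::{finite, ab_group_add} list" where "D > 0" and "length L = D" and "\<not> of_nat p dvd aug_prod L"
    and "\<And>M :: 'a list. length M = D + 1 \<Longrightarrow> of_nat p dvd aug_prod M"
proof -
  define P where "P = (\<lambda>n. \<forall>L :: 'a list. length L = n \<longrightarrow> of_nat p dvd aug_prod L)"
  define n where "n = (LEAST n. P n)"
  have "P (CARD('a) * p ^ k + 1)"
    unfolding P_def using aug_prod_nilpotent[OF assms(1,2)] by blast
  then have n: "P n"
    unfolding n_def by (rule LeastI)
  have "\<not> int p dvd 1"
    using assms(1) by auto
  then have "\<not> P 0"
    by (auto simp: P_def of_nat_dvd_iff_lookup lookup_one when_def)
  obtain a :: 'a where "a \<noteq> 0"
    using assms(3) by (metis UNIV_I card_1_singleton_iff is_singletonI' is_singleton_altdef less_irrefl empty_iff)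
  then have "Poly_Mapping.lookup (tau a - 1) a = 1"
    by (simp add: lookup_minus lookup_tau lookup_one)
  with \<open>\<not> int p dvd 1\<close> have "\<not> of_nat p dvd aug_prod [a]"
    by (auto simp: of_nat_dvd_iff_lookup intro: exI[of _ a])
  then have "\<not> P 1"
    unfolding P_def by (metis One_nat_def length_Cons list.size(3))
  \<comment> \<open>The result is obtained with \<open>D = n - 1\<close>, so \<open>D > 0\<close>
    needs both 0 and 1 excluded.\<close>
  have "n \<ge> 2"
    using n \<open>\<not> P 0\<close> \<open>\<not> P 1\<close> by (metis One_nat_def less_2_cases not_le)
  then have "\<not> P (n - 1)"
    using not_less_Least[of "n - 1" P] by (simp add: n_def)
  with n \<open>n \<ge> 2\<close> that[of "n - 1"] show ?thesis
    by (auto simp: P_def)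
qed

section \<open>Tensor powers of group ring elements\<close>

text \<open>The right-hand side is the image of \<open>aug_prod L\<close> under the ring
  homomorphism of group rings induced by \<phi>, written out in coefficients.\<close>

lemma aug_prod_map_hom:
  fixes L :: "'a::{finite, ab_group_add} list"
  assumes hom: "\<And>a b. \<phi> (a + b) = \<phi> a + \<phi> b"
  shows "aug_prod (map \<phi> L) = (\<Sum>a\<in>UNIV. of_int (Poly_Mapping.lookup (aug_prod L) a) * tau (\<phi> a))"
proof (induction L)
  case Nil
  have "\<phi> 0 = 0"
    using hom[of 0 0] by simp
  moreover have "of_int (Poly_Mapping.lookup (1 :: 'a \<Rightarrow>\<^sub>0 int) a) * tau (\<phi> a) =
      (if a = 0 then tau (\<phi> 0) else 0)" for a
    by (simp add: lookup_one when_def)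
  ultimately show ?case
    by (simp add: tau_zero)
next
  case (Cons b L)
  let ?c = "Poly_Mapping.lookup (aug_prod L)"
  have "(\<Sum>a\<in>UNIV. of_int (Poly_Mapping.lookup (aug_prod (b # L)) a) * tau (\<phi> a)) =
      (\<Sum>a\<in>UNIV. of_int (?c (a - b)) * tau (\<phi> a)) - (\<Sum>a\<in>UNIV. of_int (?c a) * tau (\<phi> a))"
    by (simp add: left_diff_distrib lookup_minus mult.commute[of "tau b"] lookup_times_tau
        sum_subtractf)
  also have "(\<Sum>a\<in>UNIV. of_int (?c (a - b)) * tau (\<phi> a)) =
      (\<Sum>a\<in>UNIV. of_int (?c a) * (tau (\<phi> a) * tau (\<phi> b)))"
    by (rule sum.reindex_bij_witness[of _ "\<lambda>a. a + b" "\<lambda>a. a - b"])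
      (simp_all add: tau_mult flip: hom)
  also have "\<dots> - (\<Sum>a\<in>UNIV. of_int (?c a) * tau (\<phi> a)) = aug_prod (map \<phi> (b # L))"
    by (simp add: Cons.IH left_diff_distrib right_diff_distrib sum_subtractf sum_distrib_left mult_ac)
  finally show ?case ..
qed

text \<open>The product of the \<open>N\<close> coordinate copies of an element of \<open>\<int>[A]\<close> is its \<open>N\<close>-th tensor power,
  an element of \<open>\<int>[A\<^sup>N]\<close>.\<close>

lemma lookup_prod_axis:
  fixes F :: "'a::{finite, ab_group_add} \<Rightarrow>\<^sub>0 int" and y :: "'a ^ 'n"
  shows "Poly_Mapping.lookup
      (\<Prod>j\<in>UNIV. \<Sum>a\<in>UNIV. of_int (Poly_Mapping.lookup F a) * tau (axis j a :: 'a ^ 'n)) y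
    = (\<Prod>j\<in>UNIV. Poly_Mapping.lookup F (y $ j))"
proof -
  let ?c = "Poly_Mapping.lookup F"
  have prod_tau: "(\<Prod>j\<in>X. tau (g j)) = tau (\<Sum>j\<in>X. g j)" for X and g :: "'n \<Rightarrow> 'a ^ 'n"
    by (induction X rule: infinite_finite_induct) (simp_all add: tau_zero tau_mult)
  have axes: "(\<Sum>j\<in>UNIV. axis j (g j)) = (\<chi> j. g j)" for g :: "'n \<Rightarrow> 'a"
    by (simp add: vec_eq_iff sum_component axis_def if_distrib cong: if_cong)
  \<comment> \<open>Expanding the product chooses one group element per coordinate; these choices
    are exactly the points of \<open>'a ^ 'n\<close>.\<close>
  have "(\<Prod>j\<in>UNIV. \<Sum>a\<in>UNIV. of_int (?c a) * tau (axis j a :: 'a ^ 'n)) =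
      (\<Sum>g\<in>UNIV. \<Prod>j\<in>UNIV. of_int (?c (g j)) * tau (axis j (g j) :: 'a ^ 'n))"
    by (subst prod_sum_PiE) (simp_all add: PiE_UNIV_domain)
  also have "\<dots> = (\<Sum>g\<in>UNIV. of_int (\<Prod>j\<in>UNIV. ?c (g j)) * tau (\<chi> j. g j))"
    by (simp add: prod.distrib prod_tau axes)
  also have "Poly_Mapping.lookup \<dots> y =
      (\<Sum>g\<in>UNIV. if g = ($) y then \<Prod>j\<in>UNIV. ?c (g j) else 0)"
    unfolding lookup_sum lookup_of_int_times lookup_tau
    by (rule sum.cong) (auto simp: vec_eq_iff fun_eq_iff)
  finally show ?thesis
    by simp
qed

lemma ex_aug_prod_vec:
  fixes L :: "'a::{finite, ab_group_add} list"
  assumes "prime p" and "\<not> of_nat p dvd aug_prod L"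
  obtains M :: "('a ^ 'n) list" where "length M = CARD('n) * length L" and "\<not> of_nat p dvd aug_prod M"
proof -
  obtain js :: "'n list" where js: "set js = UNIV" "distinct js"
    using finite_distinct_list[OF finite_class.finite_UNIV] by blast
  define M where "M = concat (map (\<lambda>j. map (axis j) L) js)"
  have card_js: "length js = CARD('n)"
    using js distinct_card by fastforce
  have "length M = length js * length L"
    unfolding M_def by (induction js) simp_all
  have "aug_prod M = (\<Prod>j\<leftarrow>js. aug_prod (map (axis j) L))"
    unfolding M_def by (induction js) simp_all
  then have "aug_prod M = (\<Prod>j\<in>UNIV. aug_prod (map (axis j) L))"
    using js by (simp add: prod.distinct_set_conv_list flip: js(1))
  then have M: "aug_prod M = (\<Prod>j\<in>UNIV. \<Sum>a\<in>UNIV.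
      of_int (Poly_Mapping.lookup (aug_prod L) a) * tau (axis j a :: 'a ^ 'n))"
    by (subst (asm) aug_prod_map_hom) (simp_all add: axis_def vec_eq_iff)
  obtain b where b: "\<not> int p dvd Poly_Mapping.lookup (aug_prod L) b"
    using assms(2) by (auto simp: of_nat_dvd_iff_lookup)
  \<comment> \<open>At the constant vector all \<open>N\<close> factors of the coefficient agree,
    and a prime dividing their product would divide the coefficient at \<open>b\<close>.\<close>
  have "Poly_Mapping.lookup (aug_prod M) (\<chi> j. b) = Poly_Mapping.lookup (aug_prod L) b ^ CARD('n)"
    unfolding M lookup_prod_axis by simp
  moreover have "\<not> int p dvd Poly_Mapping.lookup (aug_prod L) b ^ CARD('n)"
    using b assms(1) prime_dvd_power[of "int p"] by auto
  ultimately have "\<not> of_nat p dvd aug_prod M"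
    by (metis of_nat_dvd_iff_lookup)
  with \<open>length M = length js * length L\<close> show ?thesis
    using that card_js by simp
qed

section \<open>The indicator function of a one-point zero set\<close>

theorem theorem10p2:
  fixes p r :: nat
    and f :: "nat \<Rightarrow> ('a::{finite, ab_group_add}) ^ 'n \<Rightarrow> 'a"
  assumes "prime p"
    and "\<exists>k. CARD('a) = p ^ k"
    and "CARD('a) > 1"
    and "r \<ge> 1"
    and "enat CARD('n) > (\<Sum>i=1..r. Fdeg (f i))"
  shows "\<not> is_singleton {a. \<forall>i\<in>{1..r}. f i a = 0}"
proof
  let ?V = "{a. \<forall>i\<in>{1..r}. f i a = 0}"
  assume "is_singleton ?V"
  then obtain v where v: "?V = {v}"
    by (rule is_singletonE)
  have "Fdeg (f i) \<noteq> \<infinity>" if "i \<in> {1..r}" for i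
  proof
    assume "Fdeg (f i) = \<infinity>"
    moreover have "Fdeg (f i) \<le> (\<Sum>i=1..r. Fdeg (f i))"
      using that by (intro member_le_sum) simp_all
    ultimately show False
      using assms(5) by simp
  qed
  then have "\<forall>i\<in>{1..r}. \<exists>d. Fdeg (f i) = enat d"
    by simp
  then obtain m where m: "\<forall>i\<in>{1..r}. Fdeg (f i) = enat (m i)"
    by (rule bchoice[THEN exE])
  have "(\<Sum>i=1..r. Fdeg (f i)) = (\<Sum>i=1..r. enat (m i))"
    using m by (intro sum.cong) auto
  also have "\<dots> = enat (\<Sum>i=1..r. m i)"
    by (induction r) (simp_all add: zero_enat_def)
  finally have N: "(\<Sum>i=1..r. m i) < CARD('n)"
    using assms(5) by simp

  obtain k where "CARD('a) = p ^ k"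
    using assms(2) ..
  then obtain D and L :: "'a list" where D: "D > 0" "length L = D"
    and L: "\<not> of_nat p dvd aug_prod L"
    and nilpotent: "\<And>M :: 'a list. length M = D + 1 \<Longrightarrow> of_nat p dvd aug_prod M"
    using ex_maximal_aug_prod[OF assms(1) _ assms(3)] by metis
  interpret filtration "aug_filt p :: nat \<Rightarrow> ('a \<Rightarrow>\<^sub>0 int) set"
    by (rule filtration_aug_filt)
  interpret module "(*) :: ('a \<Rightarrow>\<^sub>0 int) \<Rightarrow> _ \<Rightarrow> _"
    by (rule module_times)
  have "subspace {x :: 'a \<Rightarrow>\<^sub>0 int. of_nat p dvd x}"
    by (rule subspaceI) auto
  then have le_p: "aug_filt p (D + 1) \<subseteq> {x :: 'a \<Rightarrow>\<^sub>0 int. of_nat p dvd x}"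
    unfolding aug_filt_def ideal_gen_def using nilpotent by (intro span_minimal) auto
  have tau_mem: "tau a - 1 \<in> (aug_filt p 1 :: ('a \<Rightarrow>\<^sub>0 int) set)" for a
    unfolding aug_filt_def ideal_gen_def
    by (intro span_base insertI2 image_eqI[of _ _ "[a]"]) simp_all

  \<comment> \<open>This is 1 where \<open>f i\<close> vanishes and 0 elsewhere.\<close>
  define g where "g = (\<lambda>i x. Poly_Mapping.lookup (tau (f i x)) 0)"
  have "diffs_in {z. int p dvd z} (D * m i + 1) (g i)" if "i \<in> {1..r}" for i
  proof -
    have "diffs_in (aug_filt p (D + 1)) (D * m i + 1) (\<lambda>x. tau (f i x))"
      using Fdeg_imp_diffs_in[OF m[rule_format, OF that]]
      by (intro diffs_in_hom) (simp_all add: tau_mult tau_zero tau_mem[simplified])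
    then show ?thesis
      unfolding g_def
      by (rule diffs_in_image) (use le_p in \<open>auto simp: lookup_minus of_nat_dvd_iff_lookup\<close>)
  qed
  then have "diffs_in {z. int p dvd z} ((\<Sum>i=1..r. D * m i) + 1) (\<lambda>x. \<Prod>i=1..r. g i x)"
    by (intro diffs_in_dvd_prod) simp_all
  moreover have "(\<Prod>i=1..r. g i x) = (if x = v then 1 else 0)" for x
  proof -
    have "x = v \<longleftrightarrow> (\<forall>i\<in>{1..r}. f i x = 0)"
      using v by blast
    then show ?thesis
      by (auto simp: g_def lookup_tau)
  qed
  \<comment> \<open>The strict inequality in the hypothesis leaves room for a further
    \<open>D\<close>, which covers the extra 1 because \<open>D > 0\<close>.\<close>
  moreover have "(\<Sum>i=1..r. D * m i) + 1 \<le> CARD('n) * D"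
  proof -
    have "D * (\<Sum>i=1..r. m i) + 1 \<le> D * ((\<Sum>i=1..r. m i) + 1)"
      using D by simp
    also have "\<dots> \<le> D * CARD('n)"
      using N by (intro mult_le_mono2) simp
    finally show ?thesis
      by (simp add: sum_distrib_left mult.commute)
  qed
  ultimately have deg: "diffs_in {z. int p dvd z} (CARD('n) * D) (\<lambda>x. if x = v then 1 else 0)"
    by (simp only: diffs_in_dvd_mono)
  obtain M :: "('a ^ 'n) list" where M: "length M = CARD('n) * D" "\<not> of_nat p dvd aug_prod M"
    using ex_aug_prod_vec[OF assms(1) L] D by metis
  have "int p dvd Poly_Mapping.lookup (aug_prod M) b" for b
  proof -
    \<comment> \<open>Evaluated at \<open>v - b\<close>, the indicator of \<open>v\<close> singles
      out the coefficient at \<open>b\<close>, so \<open>p\<close> divides every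
      coefficient.\<close>
    have "act (aug_prod M) (\<lambda>x. if x = v then 1 else 0 :: int) (v - b) =
        (\<Sum>a\<in>UNIV. if a = b then Poly_Mapping.lookup (aug_prod M) a else 0)"
      unfolding act_eq_sum_UNIV int_mult_int by (rule sum.cong) (auto simp: algebra_simps)
    moreover have "int p dvd act (aug_prod M) (\<lambda>x. if x = v then 1 else 0) (v - b)"
      using deg[unfolded diffs_in_iff_act] M(1) by blast
    ultimately show ?thesis
      by simp
  qed
  with M(2) show False
    by (simp add: of_nat_dvd_iff_lookup)
qed

end
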